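(* Let $(X_i)_{i\in\mathbb Z}$ be the Holroyd–Liggett $1$-dependent $4$-coloring of $\mathbb Z$ (defined in the context), and let $\iota:\{1,2,3,4\}\to\{1,2,\star\}$ be given by $\iota(1)=1$, $\iota(2)=2$, $\iota(3)=\iota(4)=\star$. Then the process $(\iota(X_i))_{i\in\mathbb Z}$ cannot be expressed as a $2$-block-factor of an i.i.d. process; that is, there is no i.i.d. process $(U_i)_{i\in\mathbb Z}$ and (measurable) function $f$ such that $(\iota(X_i))_{i\in\mathbb Z}$ is equal in law to $(f(U_i,U_{i+1}))_{i\in\mathbb Z}$.
   Context: **Holroyd–Liggett coloring.** Let $q=4$. A word $x=x_1\cdots x_n\in\{1,\ldots,q\}^n$ is proper if $x_i\ne x_{i+1}$ for all $1\le i\le n-1$. Write $\hat x_i$ for the word of length $n-1$ obtained from $x$ by deleting its $i$-th letter. Define $\vec B(\emptyset)=1$ for the empty word and recursively $$\vec B(x)=\mathbf 1[x\text{ is proper}]\sum_{i=1}^n\vec B(\hat x_i),\qquad n\ge 1,\ x\in\{1,\ldots,q\}^n,$$ and let $\vec Z(n,q)=\sum_{y\in\{1,\ldots,q\}^n}\vec B(y)$. The $1$-dependent $4$-coloring $(X_i)_{i\in\mathbb Z}$ is the stationary process whose law is characterized by $\mathbb P\bigl((X_1,\ldots,X_n)=x\bigr)=\vec B(x)/\vec Z(n,4)$ for all $n\ge 0$ and $x\in\{1,2,3,4\}^n$. **Block factors.** A process $(Z_i)_{i\in\mathbb Z}$ is an $r$-block-factor of an i.i.d. process $(U_i)_{i\in\mathbb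 Z}$ if $Z_i=f(U_i,\ldots,U_{i+r-1})$ for all $i$ and a fixed function $f$. *)

theory Defs
  imports "HOL-Probability.Probability"
begin

definition words :: "nat \<Rightarrow> nat \<Rightarrow> nat list set" where
  "words q n = {x. length x = n \<and> set x \<subseteq> {1..q}}"

definition delete_nth :: "nat \<Rightarrow> 'a list \<Rightarrow> 'a list" where
  "delete_nth i x = take i x @ drop (Suc i) x"

lemma length_delete_nth: "i < length x \<Longrightarrow> length (delete_nth i x) < length x"
  by (simp add: delete_nth_def)

text \<open>The weights \<open>B\<close> and their sum \<open>Z\<close>; a word is proper iff it is \<^const>\<open>distinct_adj\<close>,
  and positions are counted from 0.\<close>

function hl_B :: "nat list \<Rightarrow> nat" where
  "hl_B x = (if x = [] then 1
     else of_bool (distinct_adj x) * (\<Sum>i<length x. hl_B (delete_nth i x)))"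
  by auto
termination
  by (relation "Wellfounded.measure length") (auto intro: length_delete_nth)

declare hl_B.simps [simp del]

definition hl_Z :: "nat \<Rightarrow> nat \<Rightarrow> nat" where
  "hl_Z n q = (\<Sum>y\<in>words q n. hl_B y)"

text \<open>The law of a process indexed by the integers, on the product \<open>\<sigma>\<close>-algebra over the state
  space \<open>S\<close>.\<close>

definition process_law ::
    "'w measure \<Rightarrow> 's measure \<Rightarrow> (int \<Rightarrow> 'w \<Rightarrow> 's) \<Rightarrow> (int \<Rightarrow> 's) measure" where
  "process_law M S X = distr M (\<Pi>\<^sub>M i\<in>UNIV. S) (\<lambda>\<omega> i. X i \<omega>)"

definition stationary :: "'w measure \<Rightarrow> 's measure \<Rightarrow> (int \<Rightarrow> 'w \<Rightarrow> 's) \<Rightarrow> bool" where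
  "stationary M S X \<longleftrightarrow> (\<forall>k. process_law M S (\<lambda>i. X (i + k)) = process_law M S X)"

definition hl_coloring :: "'w measure \<Rightarrow> (int \<Rightarrow> 'w \<Rightarrow> nat) \<Rightarrow> bool" where
  "hl_coloring M X \<longleftrightarrow>
     prob_space M \<and>
     (\<forall>i. X i \<in> measurable M (count_space {1..4})) \<and>
     stationary M (count_space {1..4}) X \<and>
     (\<forall>n. \<forall>x\<in>words 4 n.
        measure M {\<omega>\<in>space M. map (\<lambda>i. X i \<omega>) [1..int n] = x} = real (hl_B x) / real (hl_Z n 4))"

definition iid_process :: "'w measure \<Rightarrow> 's measure \<Rightarrow> (int \<Rightarrow> 'w \<Rightarrow> 's) \<Rightarrow> bool" where
  "iid_process M S U \<longleftrightarrow>
     prob_space M \<and>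
     prob_space.indep_vars M (\<lambda>_. S) U UNIV \<and>
     (\<forall>i j. distr M S (U i) = distr M S (U j))"

datatype symbol = One | Two | Star

text \<open>Only the values on \<open>{1..4}\<close> matter.\<close>

definition iota :: "nat \<Rightarrow> symbol" where
  "iota c = (if c = 1 then One else if c = 2 then Two else Star)"

end

theory Submission
  imports Defs
begin

text \<open>
  Suppose that the coloring, reduced to the symbols \<open>1\<close>, \<open>2\<close> and \<open>\<star>\<close>, were
  \<open>f (U i, U (i + 1))\<close> with \<open>U\<close> i.i.d. of law \<open>D\<close>. Only five probabilities matter: each of the
  symbols \<open>1\<close> and \<open>2\<close> has probability \<open>1/4\<close>, the words \<open>11\<close> and \<open>22\<close> have probability \<open>0\<close>, and
  the word \<open>12\<close> has probability \<open>1/12\<close>. They are rigid enough to determine where \<open>f\<close>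
  takes the values \<open>1\<close> and \<open>2\<close>.

  Let \<open>A\<close> be the set of pairs on which \<open>f = 1\<close>. As \<open>11\<close> never occurs, almost no point is both the
  first coordinate of a non-negligible part of \<open>A\<close> and the second coordinate of such a part. So
  \<open>A\<close> lies, up to a null set, in \<open>S \<times> (- S)\<close>, where \<open>S\<close> is the set of points of the first kind.
  This product has mass \<open>D S * (1 - D S) \<le> 1/4\<close>, while \<open>A\<close> has mass exactly \<open>1/4\<close>. Hence
  \<open>D S = 1/2\<close>, and \<open>A = S \<times> (- S)\<close> almost everywhere (lemma \<open>extremal_unrepeatable_set\<close>). In the
  same way \<open>f = 2\<close> on a product \<open>R \<times> (- R)\<close> with \<open>D R = 1/2\<close>.

  The two products are disjoint, so \<open>S \<inter> R\<close> or the complement of \<open>S \<union> R\<close> is a null set.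
  As \<open>D S + D R = 1\<close>, these two sets have equal mass, so both are null and \<open>R\<close> is
  essentially the complement of \<open>S\<close> (lemma \<open>halves_disjoint_if_products_disjoint\<close>). But then the word \<open>12\<close> means
  that \<open>U 1 \<in> S\<close>, \<open>U 2 \<notin> S\<close> and \<open>U 3 \<in> S\<close>, which has probability \<open>1/8\<close> and not \<open>1/12\<close>.
\<close>

section \<open>Short words of the coloring\<close>

lemma hl_B_Nil: "hl_B [] = 1"
  by (simp add: hl_B.simps)

lemma hl_B_singleton: "hl_B [a] = 1"
  by (subst hl_B.simps) (simp add: delete_nth_def hl_B_Nil)

lemma hl_B_pair: "hl_B [a, b] = (if a = b then 0 else 2)"
  by (subst hl_B.simps) (simp add: delete_nth_def hl_B_singleton lessThan_Suc)

lemma words_1: "words q 1 = (\<lambda>a. [a]) ` {1..q}"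
  by (auto simp: words_def length_Suc_conv)

lemma words_2: "words q 2 = (\<lambda>(a, b). [a, b]) ` ({1..q} \<times> {1..q})"
  by (auto simp: words_def length_Suc_conv numeral_2_eq_2)

lemma hl_Z_1: "hl_Z 1 q = q"
  unfolding hl_Z_def words_1
  by (subst sum.reindex) (auto simp: inj_on_def hl_B_singleton)

lemma hl_Z_2: "hl_Z 2 q = 2 * q * (q - 1)"
proof -
  have "hl_Z 2 q = (\<Sum>p\<in>{1..q} \<times> {1..q}. hl_B [fst p, snd p])"
    unfolding hl_Z_def words_2
    by (subst sum.reindex) (auto simp: inj_on_def case_prod_beta)
  also have "\<dots> = (\<Sum>a\<in>{1..q}. \<Sum>b\<in>{1..q}. if a = b then 0 else 2)"
    by (simp add: sum.cartesian_product case_prod_beta hl_B_pair)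
  also have "\<dots> = (\<Sum>a\<in>{1..q}. \<Sum>b\<in>{1..q} - {a}. 2)"
    by (intro sum.cong refl sum.mono_neutral_cong_right) auto
  also have "\<dots> = 2 * q * (q - 1)"
    by simp
  finally show ?thesis .
qed

lemma hl_coloring_prob_1:
  assumes "hl_coloring N X" "a \<in> {1..4}"
  shows "measure N {\<omega>\<in>space N. X 1 \<omega> = a} = 1 / 4"
proof -
  have "[a] \<in> words 4 1"
    using assms(2) by (simp add: words_def)
  then have "measure N {\<omega>\<in>space N. map (\<lambda>i. X i \<omega>) [1..int 1] = [a]} = hl_B [a] / hl_Z 1 4"
    using assms(1) unfolding hl_coloring_def by blast
  then show ?thesis
    unfolding hl_Z_1 hl_B_singleton by simp
qed

lemma hl_coloring_prob_2:
  assumes "hl_coloring N X" "a \<in> {1..4}" "b \<in> {1..4}"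
  shows "measure N {\<omega>\<in>space N. X 1 \<omega> = a \<and> X 2 \<omega> = b} = (if a = b then 0 else 1 / 12)"
proof -
  have "[a, b] \<in> words 4 2"
    using assms(2,3) by (simp add: words_def)
  then have "measure N {\<omega>\<in>space N. map (\<lambda>i. X i \<omega>) [1..int 2] = [a, b]} = hl_B [a, b] / hl_Z 2 4"
    using assms(1) unfolding hl_coloring_def by blast
  moreover have "[1..int 2] = [1, 2]"
    by (simp add: upto_rec1)
  ultimately show ?thesis
    unfolding hl_Z_2 hl_B_pair by (simp split: if_splits)
qed

section \<open>Sets of pairs that cannot occur twice in a row\<close>

text \<open>
  If almost no \<open>v\<close> can end a pair in \<open>A\<close> and also start one, then the starting points and the
  end points of \<open>A\<close> are essentially disjoint, so \<open>A\<close> has mass at most \<open>p * (1 - p)\<close>, where \<open>p\<close>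
  is the mass of the starting points. The mass \<open>1/4\<close> is the maximum of this bound, and equality
  leaves no freedom.
\<close>

lemma extremal_unrepeatable_set:
  assumes "prob_space D"
    and A: "A \<in> sets (D \<Otimes>\<^sub>M D)"
    and mA: "measure (D \<Otimes>\<^sub>M D) A = 1 / 4"
    and unrep: "AE v in D. (AE u in D. (u, v) \<notin> A) \<or> (AE w in D. (v, w) \<notin> A)"
  obtains S where "S \<in> sets D" "measure D S = 1 / 2"
    "AE p in D \<Otimes>\<^sub>M D. p \<in> A \<longleftrightarrow> fst p \<in> S \<and> snd p \<notin> S"
proof -
  interpret D: prob_space D by fact
  interpret DD: pair_prob_space D D ..
  define S where "S = {v\<in>space D. emeasure D (Pair v -` A) \<noteq> 0}"
  define T where "T = {v\<in>space D. emeasure D ((\<lambda>u. (u, v)) -` A) \<noteq> 0}"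
  have S: "S \<in> sets D"
    unfolding S_def using D.measurable_emeasure_Pair[OF A] by measurable
  have T: "T \<in> sets D"
    unfolding T_def using DD.measurable_emeasure_Pair2[OF A] by measurable
  have secS: "v \<in> S \<longleftrightarrow> \<not> (AE w in D. (v, w) \<notin> A)" if "v \<in> space D" for v
  proof -
    have "{w\<in>space D. \<not> (v, w) \<notin> A} = Pair v -` A"
      using sets.sets_into_space[OF A] by (auto simp: space_pair_measure)
    then show ?thesis
      using that sets_Pair1[OF A, of v] by (simp add: S_def AE_iff_measurable[OF _ refl])
  qed
  have secT: "v \<in> T \<longleftrightarrow> \<not> (AE u in D. (u, v) \<notin> A)" if "v \<in> space D" for v
  proof -
    have "{u\<in>space D. \<not> (u, v) \<notin> A} = (\<lambda>u. (u, v)) -` A"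
      using sets.sets_into_space[OF A] by (auto simp: space_pair_measure)
    then show ?thesis
      using that sets_Pair2[OF A, of v] by (simp add: T_def AE_iff_measurable[OF _ refl])
  qed
  have TS: "AE v in D. v \<in> T \<longrightarrow> v \<notin> S"
    using unrep AE_space by eventually_elim (auto simp: secS secT)
  \<comment> \<open>Pairs in \<open>A\<close> go from \<open>S\<close> to \<open>T\<close>, and \<open>T\<close> is almost surely outside \<open>S\<close>.\<close>
  define Q where "Q = S \<times> (space D - S)"
  have Q: "Q \<in> sets (D \<Otimes>\<^sub>M D)"
    unfolding Q_def using S by auto
  have first: "AE p in D \<Otimes>\<^sub>M D. p \<in> A \<longrightarrow> fst p \<in> S"
  proof (rule DD.AE_pair_measure)
    show "{p \<in> space (D \<Otimes>\<^sub>M D). p \<in> A \<longrightarrow> fst p \<in> S} \<in> sets (D \<Otimes>\<^sub>M D)"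
      using A S by measurable
    show "AE u in D. AE v in D. (u, v) \<in> A \<longrightarrow> fst (u, v) \<in> S"
      using AE_space
    proof eventually_elim
      case (elim u)
      then show ?case using secS[of u] by (cases "u \<in> S") auto
    qed
  qed
  have "AE u in D. AE v in D. (u, v) \<in> A \<longrightarrow> v \<in> T"
  proof (subst DD.AE_commute)
    show "{p \<in> space (D \<Otimes>\<^sub>M D). (fst p, snd p) \<in> A \<longrightarrow> snd p \<in> T} \<in> sets (D \<Otimes>\<^sub>M D)"
      using A T by measurable
    show "AE v in D. AE u in D. (u, v) \<in> A \<longrightarrow> v \<in> T"
      using AE_space
    proof eventually_elim
      case (elim v)
      then show ?case using secT[of v] by (cases "v \<in> T") auto
    qed
  qed
  then have second: "AE p in D \<Otimes>\<^sub>M D. p \<in> A \<longrightarrow> snd p \<notin> S"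
  proof (intro DD.AE_pair_measure)
    show "{p \<in> space (D \<Otimes>\<^sub>M D). p \<in> A \<longrightarrow> snd p \<notin> S} \<in> sets (D \<Otimes>\<^sub>M D)"
      using A S by measurable
    assume "AE u in D. AE v in D. (u, v) \<in> A \<longrightarrow> v \<in> T"
    then show "AE u in D. AE v in D. (u, v) \<in> A \<longrightarrow> snd (u, v) \<notin> S"
    proof eventually_elim
      case (elim u)
      with TS show ?case by eventually_elim auto
    qed
  qed
  have AQ: "AE p in D \<Otimes>\<^sub>M D. p \<in> A \<longrightarrow> p \<in> Q"
    using first second AE_space
    by eventually_elim (auto simp: Q_def space_pair_measure mem_Times_iff)
  have mQ: "measure (D \<Otimes>\<^sub>M D) Q = measure D S * (1 - measure D S)"
    unfolding Q_def using S D.prob_compl[OF S]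
    by (simp add: measure_def D.emeasure_pair_measure_Times enn2real_mult)
  have "1 / 4 \<le> measure D S * (1 - measure D S)"
    using DD.finite_measure_mono_AE[OF AQ Q] mA mQ by simp
  then have "(measure D S - 1 / 2)\<^sup>2 \<le> 0"
    by (simp add: power2_eq_square algebra_simps)
  then have half: "measure D S = 1 / 2"
    by simp
  \<comment> \<open>The sets now have the same mass, so that the almost sure inclusion is an equality.\<close>
  have "measure (D \<Otimes>\<^sub>M D) (Q - A) = 0"
  proof -
    have "measure (D \<Otimes>\<^sub>M D) (Q \<inter> A) = measure (D \<Otimes>\<^sub>M D) A"
      using AQ A Q by (intro DD.finite_measure_eq_AE) auto
    then show ?thesis
      using DD.finite_measure_Diff'[OF Q A] mA mQ half by simp
  qed
  then have "AE p in D \<Otimes>\<^sub>M D. p \<notin> Q - A"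
    using A Q by (intro AE_not_in) (auto simp: null_sets_def DD.emeasure_eq_measure)
  then have "AE p in D \<Otimes>\<^sub>M D. p \<in> A \<longleftrightarrow> fst p \<in> S \<and> snd p \<notin> S"
    using AQ AE_space
    by eventually_elim (auto simp: Q_def space_pair_measure mem_Times_iff)
  with S half show thesis
    by (rule that)
qed

text \<open>
  A null intersection of the products forces \<open>S \<inter> R\<close> or the complement of \<open>S \<union> R\<close> to be null, and
  for two sets of mass \<open>1/2\<close> these have the same mass.
\<close>

lemma halves_disjoint_if_products_disjoint:
  assumes "prob_space D"
    and S: "S \<in> sets D" "measure D S = 1 / 2"
    and R: "R \<in> sets D" "measure D R = 1 / 2"
    and disj: "AE p in D \<Otimes>\<^sub>M D. \<not> ((fst p \<in> S \<and> snd p \<notin> S) \<and> (fst p \<in> R \<and> snd p \<notin> R))"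
  shows "measure D (S \<inter> R) = 0"
proof -
  interpret D: prob_space D by fact
  interpret DD: pair_prob_space D D ..
  let ?Q = "(S \<inter> R) \<times> (space D - (S \<union> R))"
  have "AE p in D \<Otimes>\<^sub>M D. p \<in> ?Q \<longleftrightarrow> p \<in> {}"
    using disj by eventually_elim auto
  then have "measure (D \<Otimes>\<^sub>M D) ?Q = measure (D \<Otimes>\<^sub>M D) {}"
    using S R by (intro DD.finite_measure_eq_AE) auto
  then have "measure D (S \<inter> R) * measure D (space D - (S \<union> R)) = 0"
    using S R by (simp add: measure_def D.emeasure_pair_measure_Times enn2real_mult)
  moreover have "measure D (S \<union> R) = 1 - measure D (S \<inter> R)"
    using S R D.finite_measure_Union'[OF S(1) R(1)] D.finite_measure_Diff'[OF R(1) S(1)]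
    by (simp add: Int_commute)
  then have "measure D (space D - (S \<union> R)) = measure D (S \<inter> R)"
    using S R D.prob_compl[of "S \<union> R"] by auto
  ultimately show ?thesis
    by simp
qed

section \<open>Joint laws of an i.i.d. process\<close>

lemma (in prob_space) distr_triple_if_indep_vars:
  fixes U :: "'i \<Rightarrow> 'a \<Rightarrow> 's"
  assumes indep: "indep_vars (\<lambda>_. S) U UNIV" and ij: "i \<noteq> j" "i \<noteq> k"
  shows "distr M (S \<Otimes>\<^sub>M (S \<Otimes>\<^sub>M S)) (\<lambda>\<omega>. (U i \<omega>, U j \<omega>, U k \<omega>)) =
    distr M S (U i) \<Otimes>\<^sub>M distr M (S \<Otimes>\<^sub>M S) (\<lambda>\<omega>. (U j \<omega>, U k \<omega>))"
proof -
  have U [measurable]: "U l \<in> measurable M S" for l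
    using indep by (auto simp: indep_vars_def)
  \<comment> \<open>Independence of two variables is a notion for variables with values in the same type.
    Families indexed by \<open>{i}\<close> and \<open>{j, k}\<close> share one; the value and the pair of values are
    read off from their joint law.\<close>
  define Y where "Y J \<omega> = restrict (\<lambda>l. U l \<omega>) J" for J \<omega>
  have Y [measurable]: "Y J \<in> measurable M (PiM J (\<lambda>_. S))" for J
    unfolding Y_def by measurable
  define g where "g y = (y j, y k)" for y :: "'i \<Rightarrow> 's"
  have g [measurable]: "g \<in> measurable (PiM {j, k} (\<lambda>_. S)) (S \<Otimes>\<^sub>M S)"
    unfolding g_def by measurable
  have h [measurable]: "(\<lambda>y. y i) \<in> measurable (PiM {i} (\<lambda>_. S)) S"
    by measurable
  have "indep_var (PiM {i} (\<lambda>_. S)) (Y {i}) (PiM {j, k} (\<lambda>_. S)) (Y {j, k})"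
    using ij unfolding Y_def by (intro indep_var_restrict[OF indep]) auto
  then have joint: "distr M (PiM {i} (\<lambda>_. S)) (Y {i}) \<Otimes>\<^sub>M distr M (PiM {j, k} (\<lambda>_. S)) (Y {j, k}) =
      distr M (PiM {i} (\<lambda>_. S) \<Otimes>\<^sub>M PiM {j, k} (\<lambda>_. S)) (\<lambda>\<omega>. (Y {i} \<omega>, Y {j, k} \<omega>))"
    by (simp add: indep_var_distribution_eq)
  have first: "distr M S (U i) = distr (distr M (PiM {i} (\<lambda>_. S)) (Y {i})) S (\<lambda>y. y i)"
    by (subst distr_distr) (auto simp: comp_def Y_def)
  have rest: "distr M (S \<Otimes>\<^sub>M S) (\<lambda>\<omega>. (U j \<omega>, U k \<omega>)) =
      distr (distr M (PiM {j, k} (\<lambda>_. S)) (Y {j, k})) (S \<Otimes>\<^sub>M S) g"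
    by (subst distr_distr) (auto simp: comp_def Y_def g_def)
  have sigma_finite: "sigma_finite_measure (distr M (S \<Otimes>\<^sub>M S) (\<lambda>\<omega>. (U j \<omega>, U k \<omega>)))"
    by (intro prob_space_imp_sigma_finite prob_space_distr) measurable
  have "distr M S (U i) \<Otimes>\<^sub>M distr M (S \<Otimes>\<^sub>M S) (\<lambda>\<omega>. (U j \<omega>, U k \<omega>)) =
      distr (distr M (PiM {i} (\<lambda>_. S) \<Otimes>\<^sub>M PiM {j, k} (\<lambda>_. S)) (\<lambda>\<omega>. (Y {i} \<omega>, Y {j, k} \<omega>)))
        (S \<Otimes>\<^sub>M (S \<Otimes>\<^sub>M S)) (\<lambda>(y, z). (y i, g z))"
    unfolding joint[symmetric] first rest
    by (rule pair_measure_distr) (use sigma_finite[unfolded rest] in auto)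
  also have "\<dots> = distr M (S \<Otimes>\<^sub>M (S \<Otimes>\<^sub>M S)) (\<lambda>\<omega>. (U i \<omega>, U j \<omega>, U k \<omega>))"
    by (subst distr_distr) (auto simp: comp_def Y_def g_def)
  finally show ?thesis ..
qed

lemma iid_process_distr_pair:
  assumes "iid_process M S U" "i \<noteq> j"
  shows "distr M (S \<Otimes>\<^sub>M S) (\<lambda>\<omega>. (U i \<omega>, U j \<omega>)) = distr M S (U 0) \<Otimes>\<^sub>M distr M S (U 0)"
proof -
  interpret prob_space M
    using assms(1) by (simp add: iid_process_def)
  have "indep_var (PiM {i} (\<lambda>_. S)) (\<lambda>\<omega>. restrict (\<lambda>l. U l \<omega>) {i})
      (PiM {j} (\<lambda>_. S)) (\<lambda>\<omega>. restrict (\<lambda>l. U l \<omega>) {j})"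
    using assms by (intro indep_var_restrict[where I = UNIV]) (auto simp: iid_process_def)
  then have "indep_var S ((\<lambda>y. y i) \<circ> (\<lambda>\<omega>. restrict (\<lambda>l. U l \<omega>) {i}))
      S ((\<lambda>y. y j) \<circ> (\<lambda>\<omega>. restrict (\<lambda>l. U l \<omega>) {j}))"
    by (rule indep_var_compose) measurable
  then have "indep_var S (U i) S (U j)"
    by (simp add: comp_def)
  moreover have "distr M S (U l) = distr M S (U 0)" for l
    using assms(1) unfolding iid_process_def by blast
  ultimately show ?thesis
    using indep_var_distribution_eq[of S "U i" S "U j"] by metis
qed

lemma iid_process_distr_triple:
  assumes "iid_process M S U" "i \<noteq> j" "i \<noteq> k" "j \<noteq> k"
  shows "distr M (S \<Otimes>\<^sub>M (S \<Otimes>\<^sub>M S)) (\<lambda>\<omega>. (U i \<omega>, U j \<omega>, U k \<omega>)) =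
    distr M S (U 0) \<Otimes>\<^sub>M (distr M S (U 0) \<Otimes>\<^sub>M distr M S (U 0))"
proof -
  interpret prob_space M
    using assms(1) by (simp add: iid_process_def)
  have "distr M S (U i) = distr M S (U 0)"
    using assms(1) unfolding iid_process_def by blast
  then show ?thesis
    using distr_triple_if_indep_vars[of S U i j k] iid_process_distr_pair[OF assms(1,4)] assms
    by (simp add: iid_process_def)
qed

text \<open>
  The middle variable is listed first, since the conclusion asks, for almost every value \<open>v\<close> of
  it, which of its two neighbours never completes a pair in \<open>A\<close>; given \<open>v\<close>, the neighbours are
  independent, so one of the two pairs must be almost impossible.
\<close>

lemma unrepeatable_if_AE:
  assumes iid: "iid_process M S U"
    and A: "A \<in> sets (S \<Otimes>\<^sub>M S)"
    and AE: "AE \<omega> in M. \<not> ((U 1 \<omega>, U 2 \<omega>) \<in> A \<and> (U 2 \<omega>, U 3 \<omega>) \<in> A)"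
  defines "D \<equiv> distr M S (U 0)"
  shows "AE v in D. (AE u in D. (u, v) \<notin> A) \<or> (AE w in D. (v, w) \<notin> A)"
proof -
  interpret M: prob_space M
    using iid by (simp add: iid_process_def)
  have U [measurable]: "U i \<in> measurable M S" for i
    using iid by (auto simp: iid_process_def M.indep_vars_def)
  interpret D: prob_space D
    unfolding D_def by (rule M.prob_space_distr) (rule U)
  interpret DD: pair_prob_space D D ..
  interpret DDD: pair_sigma_finite D "D \<Otimes>\<^sub>M D" ..
  note A [measurable]
  have "AE t in distr M (S \<Otimes>\<^sub>M (S \<Otimes>\<^sub>M S)) (\<lambda>\<omega>. (U 2 \<omega>, U 1 \<omega>, U 3 \<omega>)).
      case t of (v, u, w) \<Rightarrow> \<not> ((u, v) \<in> A \<and> (v, w) \<in> A)"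
  proof (subst AE_distr_iff)
    show "(\<lambda>\<omega>. (U 2 \<omega>, U 1 \<omega>, U 3 \<omega>)) \<in> measurable M (S \<Otimes>\<^sub>M (S \<Otimes>\<^sub>M S))"
      by measurable
    show "{t \<in> space (S \<Otimes>\<^sub>M (S \<Otimes>\<^sub>M S)). case t of (v, u, w) \<Rightarrow> \<not> ((u, v) \<in> A \<and> (v, w) \<in> A)}
        \<in> sets (S \<Otimes>\<^sub>M (S \<Otimes>\<^sub>M S))"
      by measurable
  qed (use AE in simp)
  then have "AE t in D \<Otimes>\<^sub>M (D \<Otimes>\<^sub>M D). case t of (v, u, w) \<Rightarrow> \<not> ((u, v) \<in> A \<and> (v, w) \<in> A)"
    unfolding D_def by (subst iid_process_distr_triple[OF iid, of 2 1 3, symmetric]) auto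
  then have "AE v in D. AE q in D \<Otimes>\<^sub>M D. \<not> ((fst q, v) \<in> A \<and> (v, snd q) \<in> A)"
    by (drule_tac DDD.AE_pair) (simp add: case_prod_beta)
  then show ?thesis
  proof eventually_elim
    case (elim v)
    then have "AE u in D. AE w in D. \<not> ((u, v) \<in> A \<and> (v, w) \<in> A)"
      by (drule_tac DD.AE_pair) simp
    then show ?case
    proof (cases "AE w in D. (v, w) \<notin> A")
      case False
      from \<open>AE u in D. AE w in D. \<not> ((u, v) \<in> A \<and> (v, w) \<in> A)\<close>
      have "AE u in D. (u, v) \<notin> A"
      proof eventually_elim
        case (elim u)
        with False show ?case by (cases "(u, v) \<in> A") auto
      qed
      then show ?thesis ..
    qed auto
  qed
qed

section \<open>Two unrepeatable values of a two-block-factor\<close>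

lemma two_block_factor_value_product:
  assumes iid: "iid_process M S U"
    and f: "f \<in> measurable (S \<Otimes>\<^sub>M S) (count_space UNIV)"
    and quarter: "measure M {\<omega>\<in>space M. f (U 1 \<omega>, U 2 \<omega>) = c} = 1 / 4"
    and unrep: "measure M {\<omega>\<in>space M. f (U 1 \<omega>, U 2 \<omega>) = c \<and> f (U 2 \<omega>, U 3 \<omega>) = c} = 0"
  defines "D \<equiv> distr M S (U 0)"
  obtains C where "C \<in> sets D" "measure D C = 1 / 2"
    "AE p in D \<Otimes>\<^sub>M D. f p = c \<longleftrightarrow> fst p \<in> C \<and> snd p \<notin> C"
proof -
  interpret M: prob_space M
    using iid by (simp add: iid_process_def)
  have U [measurable]: "U i \<in> measurable M S" for i
    using iid by (auto simp: iid_process_def M.indep_vars_def)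
  note f [measurable]
  have D: "prob_space D"
    unfolding D_def by (rule M.prob_space_distr) (rule U)
  have sets_D [measurable_cong]: "sets D = sets S"
    by (simp add: D_def)
  have space_D: "space (D \<Otimes>\<^sub>M D) = space (S \<Otimes>\<^sub>M S)"
    by (simp add: D_def space_pair_measure)
  define A where "A = {p\<in>space (S \<Otimes>\<^sub>M S). f p = c}"
  have A: "A \<in> sets (S \<Otimes>\<^sub>M S)"
    unfolding A_def by measurable
  have UA: "(U i \<omega>, U j \<omega>) \<in> A \<longleftrightarrow> f (U i \<omega>, U j \<omega>) = c" if "\<omega> \<in> space M" for i j \<omega>
    using that measurable_space[OF U] by (auto simp: A_def space_pair_measure)
  have A': "A \<in> sets (D \<Otimes>\<^sub>M D)"
    using A sets_pair_measure_cong[OF sets_D sets_D] by simp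
  have mA: "measure (D \<Otimes>\<^sub>M D) A = 1 / 4"
  proof -
    have "measure (D \<Otimes>\<^sub>M D) A = measure M {\<omega>\<in>space M. (U 1 \<omega>, U 2 \<omega>) \<in> A}"
      unfolding D_def iid_process_distr_pair[OF iid, of 1 2, symmetric, simplified]
      using A by (subst measure_distr) (auto simp: vimage_def Int_def conj_commute)
    also have "\<dots> = 1 / 4"
      using quarter by (simp add: UA cong: conj_cong)
    finally show ?thesis .
  qed
  have "AE \<omega> in M. \<omega> \<notin> {\<omega>\<in>space M. f (U 1 \<omega>, U 2 \<omega>) = c \<and> f (U 2 \<omega>, U 3 \<omega>) = c}"
    using unrep by (intro AE_not_in) (auto simp: null_sets_def M.emeasure_eq_measure)
  then have "AE \<omega> in M. \<not> ((U 1 \<omega>, U 2 \<omega>) \<in> A \<and> (U 2 \<omega>, U 3 \<omega>) \<in> A)"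
    using AE_space by eventually_elim (auto simp: UA)
  then have "AE v in D. (AE u in D. (u, v) \<notin> A) \<or> (AE w in D. (v, w) \<notin> A)"
    unfolding D_def by (rule unrepeatable_if_AE[OF iid A])
  from extremal_unrepeatable_set[OF D A' mA this] obtain C where C:
    "C \<in> sets D" "measure D C = 1 / 2"
    "AE p in D \<Otimes>\<^sub>M D. p \<in> A \<longleftrightarrow> fst p \<in> C \<and> snd p \<notin> C" .
  from C(3) AE_space have "AE p in D \<Otimes>\<^sub>M D. f p = c \<longleftrightarrow> fst p \<in> C \<and> snd p \<notin> C"
    by eventually_elim (auto simp: A_def space_D)
  with C(1,2) show thesis
    by (rule that)
qed

text \<open>
  Both of the values \<open>a\<close> and \<open>b\<close> have to be taken on products with a half, on \<open>P \<times> (- P)\<close> and on \<open>R \<times> (- R)\<close>, and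
  these are disjoint only if, up to null sets, \<open>R\<close> is the complement of \<open>P\<close>. A word \<open>ab\<close> is then three
  independent choices of a half.
\<close>

lemma two_block_factor_word_prob:
  assumes iid: "iid_process M S U"
    and f: "f \<in> measurable (S \<Otimes>\<^sub>M S) (count_space UNIV)"
    and "a \<noteq> b"
    and a: "measure M {\<omega>\<in>space M. f (U 1 \<omega>, U 2 \<omega>) = a} = 1 / 4"
      "measure M {\<omega>\<in>space M. f (U 1 \<omega>, U 2 \<omega>) = a \<and> f (U 2 \<omega>, U 3 \<omega>) = a} = 0"
    and b: "measure M {\<omega>\<in>space M. f (U 1 \<omega>, U 2 \<omega>) = b} = 1 / 4"
      "measure M {\<omega>\<in>space M. f (U 1 \<omega>, U 2 \<omega>) = b \<and> f (U 2 \<omega>, U 3 \<omega>) = b} = 0"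
  shows "measure M {\<omega>\<in>space M. f (U 1 \<omega>, U 2 \<omega>) = a \<and> f (U 2 \<omega>, U 3 \<omega>) = b} = 1 / 8"
proof -
  interpret M: prob_space M
    using iid by (simp add: iid_process_def)
  have U [measurable]: "U i \<in> measurable M S" for i
    using iid by (auto simp: iid_process_def M.indep_vars_def)
  note f [measurable]
  define D where "D = distr M S (U 0)"
  interpret D: prob_space D
    unfolding D_def by (rule M.prob_space_distr) (rule U)
  have D: "distr M S (U i) = D" for i
    using iid unfolding iid_process_def D_def by blast
  have sets_D: "sets D = sets S" and space_D: "space D = space S"
    by (simp_all add: D_def)
  obtain P where P: "P \<in> sets D" "measure D P = 1 / 2"
    "AE p in D \<Otimes>\<^sub>M D. f p = a \<longleftrightarrow> fst p \<in> P \<and> snd p \<notin> P"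
    using two_block_factor_value_product[OF iid f a, folded D_def] by blast
  obtain R where R: "R \<in> sets D" "measure D R = 1 / 2"
    "AE p in D \<Otimes>\<^sub>M D. f p = b \<longleftrightarrow> fst p \<in> R \<and> snd p \<notin> R"
    using two_block_factor_value_product[OF iid f b, folded D_def] by blast
  have [measurable]: "P \<in> sets S" "R \<in> sets S"
    using P(1) R(1) by (simp_all add: sets_D)
  have "AE p in D \<Otimes>\<^sub>M D. \<not> ((fst p \<in> P \<and> snd p \<notin> P) \<and> (fst p \<in> R \<and> snd p \<notin> R))"
    using P(3) R(3) by eventually_elim (use \<open>a \<noteq> b\<close> in auto)
  then have "measure D (P \<inter> R) = 0"
    by (rule halves_disjoint_if_products_disjoint[OF D.prob_space_axioms P(1,2) R(1,2)])
  then have mRP: "measure D (R - P) = 1 / 2"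
    using D.finite_measure_Diff'[OF R(1) P(1)] R(2) by (simp add: Int_commute)
  have mR: "measure D (space D - R) = 1 / 2"
    using D.prob_compl[OF R(1)] R(2) by simp
  have ae: "AE \<omega> in M. f (U i \<omega>, U j \<omega>) = c \<longleftrightarrow> U i \<omega> \<in> C \<and> U j \<omega> \<notin> C"
    if "i \<noteq> j" "C \<in> sets S" "AE p in D \<Otimes>\<^sub>M D. f p = c \<longleftrightarrow> fst p \<in> C \<and> snd p \<notin> C" for i j c C
  proof -
    note that(2) [measurable]
    have "AE p in distr M (S \<Otimes>\<^sub>M S) (\<lambda>\<omega>. (U i \<omega>, U j \<omega>)). f p = c \<longleftrightarrow> fst p \<in> C \<and> snd p \<notin> C"
      using that(3) unfolding iid_process_distr_pair[OF iid that(1)] D_def .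
    then show ?thesis
      by (subst (asm) AE_distr_iff) auto
  qed
  have ae12: "AE \<omega> in M. f (U 1 \<omega>, U 2 \<omega>) = a \<longleftrightarrow> U 1 \<omega> \<in> P \<and> U 2 \<omega> \<notin> P"
    by (rule ae[OF _ _ P(3)]) auto
  have ae23: "AE \<omega> in M. f (U 2 \<omega>, U 3 \<omega>) = b \<longleftrightarrow> U 2 \<omega> \<in> R \<and> U 3 \<omega> \<notin> R"
    by (rule ae[OF _ _ R(3)]) auto
  define V where "V i = (if i = 1 then P else if i = 2 then R - P else space S - R)" for i :: int
  have V: "V i \<in> sets S" for i
    unfolding V_def by auto
  \<comment> \<open>The word \<open>ab\<close> confines \<open>U 2\<close> to \<open>R - P\<close>, a set of mass \<open>1/2\<close> because \<open>P \<inter> R\<close> is null.\<close>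
  have "AE \<omega> in M. \<omega> \<in> {\<omega>\<in>space M. f (U 1 \<omega>, U 2 \<omega>) = a \<and> f (U 2 \<omega>, U 3 \<omega>) = b} \<longleftrightarrow>
      \<omega> \<in> (\<Inter>i\<in>{1, 2, 3}. U i -` V i \<inter> space M)"
    using ae12 ae23 AE_space
  proof eventually_elim
    case (elim \<omega>)
    then show ?case
      using measurable_space[OF U elim(3)] by (auto simp: V_def)
  qed
  then have "measure M {\<omega>\<in>space M. f (U 1 \<omega>, U 2 \<omega>) = a \<and> f (U 2 \<omega>, U 3 \<omega>) = b} =
      measure M (\<Inter>i\<in>{1, 2, 3}. U i -` V i \<inter> space M)"
    using V by (intro M.finite_measure_eq_AE) measurable
  also have "\<dots> = (\<Prod>i\<in>{1, 2, 3}. measure M (U i -` V i \<inter> space M))"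
    using iid V by (intro M.indep_varsD) (auto simp: iid_process_def)
  also have "\<dots> = (\<Prod>i\<in>{1, 2, 3}. measure D (V i))"
    using measure_distr[OF U V, unfolded D] by simp
  also have "\<dots> = 1 / 8"
    by (simp add: V_def space_D[symmetric] P(2) mRP mR)
  finally show ?thesis .
qed

section \<open>The obstruction\<close>

lemma measure_process_law:
  assumes [measurable]: "\<And>i. X i \<in> measurable M S"
    and P: "Measurable.pred (\<Pi>\<^sub>M i\<in>UNIV. S) P"
  shows "measure (process_law M S X) {y\<in>space (\<Pi>\<^sub>M i\<in>UNIV. S). P y} =
    measure M {\<omega>\<in>space M. P (\<lambda>i. X i \<omega>)}"
proof -
  have X: "(\<lambda>\<omega> i. X i \<omega>) \<in> measurable M (\<Pi>\<^sub>M i\<in>UNIV. S)"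
    by (rule measurable_PiM_single') (auto simp: measurable_space[OF assms(1)])
  show ?thesis
    unfolding process_law_def using P measurable_space[OF X]
    by (subst measure_distr[OF X]) (auto simp: pred_def intro!: arg_cong[where f = "measure M"])
qed

theorem theorem3:
  fixes N :: "'w measure" and X :: "int \<Rightarrow> 'w \<Rightarrow> nat"
  assumes "hl_coloring N X"
  shows "\<not> (\<exists>(M :: 'v measure) (S :: 'u measure) (U :: int \<Rightarrow> 'v \<Rightarrow> 'u) (f :: 'u \<times> 'u \<Rightarrow> symbol).
           iid_process M S U \<and>
           f \<in> measurable (S \<Otimes>\<^sub>M S) (count_space UNIV) \<and>
           process_law N (count_space UNIV) (\<lambda>i \<omega>. iota (X i \<omega>)) =
             process_law M (count_space UNIV) (\<lambda>i \<omega>. f (U i \<omega>, U (i + 1) \<omega>)))"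
proof
  assume "\<exists>(M :: 'v measure) (S :: 'u measure) (U :: int \<Rightarrow> 'v \<Rightarrow> 'u) (f :: 'u \<times> 'u \<Rightarrow> symbol).
           iid_process M S U \<and>
           f \<in> measurable (S \<Otimes>\<^sub>M S) (count_space UNIV) \<and>
           process_law N (count_space UNIV) (\<lambda>i \<omega>. iota (X i \<omega>)) =
             process_law M (count_space UNIV) (\<lambda>i \<omega>. f (U i \<omega>, U (i + 1) \<omega>))"
  then obtain M :: "'v measure" and S :: "'u measure" and U and f where
    iid: "iid_process M S U" and f: "f \<in> measurable (S \<Otimes>\<^sub>M S) (count_space UNIV)" and
    law: "process_law N (count_space UNIV) (\<lambda>i \<omega>. iota (X i \<omega>)) =
      process_law M (count_space UNIV) (\<lambda>i \<omega>. f (U i \<omega>, U (i + 1) \<omega>))"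
    by blast
  interpret M: prob_space M
    using iid by (simp add: iid_process_def)
  have U [measurable]: "U i \<in> measurable M S" for i
    using iid by (auto simp: iid_process_def M.indep_vars_def)
  note f [measurable]
  have X: "X i \<in> measurable N (count_space {1..4})" for i
    using assms by (simp add: hl_coloring_def)
  have iX: "(\<lambda>\<omega>. iota (X i \<omega>)) \<in> measurable N (count_space UNIV)" for i
    by (rule measurable_compose[OF X]) simp
  have fU: "(\<lambda>\<omega>. f (U i \<omega>, U (i + 1) \<omega>)) \<in> measurable M (count_space UNIV)" for i
    by measurable
  have transfer: "measure M {\<omega>\<in>space M. P (\<lambda>i. f (U i \<omega>, U (i + 1) \<omega>))} =
      measure N {\<omega>\<in>space N. P (\<lambda>i. iota (X i \<omega>))}"
    if "Measurable.pred (\<Pi>\<^sub>M i\<in>UNIV. count_space UNIV) P" for P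
    using measure_process_law[where X = "\<lambda>i \<omega>. f (U i \<omega>, U (i + 1) \<omega>)", OF fU that]
      measure_process_law[where X = "\<lambda>i \<omega>. iota (X i \<omega>)", OF iX that] law by simp
  have one: "measure M {\<omega>\<in>space M. f (U 1 \<omega>, U 2 \<omega>) = s} =
      measure N {\<omega>\<in>space N. iota (X 1 \<omega>) = s}" for s
    using transfer[of "\<lambda>y. y 1 = s"] by simp
  have two: "measure M {\<omega>\<in>space M. f (U 1 \<omega>, U 2 \<omega>) = s \<and> f (U 2 \<omega>, U 3 \<omega>) = t} =
      measure N {\<omega>\<in>space N. iota (X 1 \<omega>) = s \<and> iota (X 2 \<omega>) = t}" for s t
    using transfer[of "\<lambda>y. y 1 = s \<and> y 2 = t"] by simp
  have iota: "iota c = One \<longleftrightarrow> c = 1" "iota c = Two \<longleftrightarrow> c = 2" for c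
    by (simp_all add: iota_def)
  have "measure M {\<omega>\<in>space M. f (U 1 \<omega>, U 2 \<omega>) = One \<and> f (U 2 \<omega>, U 3 \<omega>) = Two} = 1 / 8"
    by (rule two_block_factor_word_prob[OF iid f])
      (simp_all add: one two iota hl_coloring_prob_1[OF assms] hl_coloring_prob_2[OF assms]
        del: One_nat_def)
  moreover have "measure M {\<omega>\<in>space M. f (U 1 \<omega>, U 2 \<omega>) = One \<and> f (U 2 \<omega>, U 3 \<omega>) = Two} = 1 / 12"
    by (simp add: two iota hl_coloring_prob_2[OF assms] del: One_nat_def)
  ultimately show False
    by simp
qed

end
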